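(* Let $R$ be a commutative ring with identity $1\neq 0$ that is not an integral domain, and let $I$ be a non-zero ideal of $R$. The following two assertions are equivalent: (1) $\overline{\Gamma}(R\Join I)$ is complete. (2) $Z(R)=\mathrm{Nil}(R)$, $I\subseteq Z(R)$, and for every $x,y\in Z(R)\setminus\{0\}$, $x^{n_x-1}y^{n_y-1}=0$.
   Context: For a commutative ring $A$ with $1\neq 0$, $Z(A)$ is the set of zero-divisors of $A$ (including $0$), $Z(A)^*=Z(A)\setminus\{0\}$, and $\mathrm{Nil}(A)$ is the set of nilpotent elements of $A$. For a nilpotent element $x$, $n_x$ denotes its index of nilpotency, i.e. the smallest positive integer $n$ with $x^n=0$. The extended zero-divisor graph $\overline{\Gamma}(A)$ is the simple graph with vertex set $Z(A)^*$ in which distinct vertices $x,y$ are adjacent if and only if there exist integers $n,m\geq 1$ with $x^ny^m=0$, $x^n\neq 0$ and $y^m\neq 0$. A graph is complete if every two distinct vertices are adjacent. For an ideal $I$ of $R$, the amalgamated duplication of $R$ along $I$ is the subring $R\Join I=\{(r,r+i) : r\in R,\ i\in I\}$ of $R\times R$. *)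

theory Defs
  imports "HOL-Algebra.Subrings" "HOL-Algebra.Ideal" "HOL-Algebra.Chinese_Remainder"
begin

definition zero_divisors :: "('a, 'm) ring_scheme \<Rightarrow> 'a set" where
  "zero_divisors A =
     {x \<in> carrier A. \<exists>y \<in> carrier A. y \<noteq> \<zero>\<^bsub>A\<^esub> \<and> x \<otimes>\<^bsub>A\<^esub> y = \<zero>\<^bsub>A\<^esub>}"

definition nilpotents :: "('a, 'm) ring_scheme \<Rightarrow> 'a set" where
  "nilpotents A = {x \<in> carrier A. \<exists>n::nat. n \<ge> 1 \<and> x [^]\<^bsub>A\<^esub> n = \<zero>\<^bsub>A\<^esub>}"

(* Meaningful only for nilpotent x; for other x the LEAST is over an empty predicate. *)
definition nilpotency_index :: "('a, 'm) ring_scheme \<Rightarrow> 'a \<Rightarrow> nat" where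
  "nilpotency_index A x = (LEAST n::nat. n \<ge> 1 \<and> x [^]\<^bsub>A\<^esub> n = \<zero>\<^bsub>A\<^esub>)"

(* A simple graph is a pair (V, E), where E is a set of two-element subsets of V. *)
type_synonym 'v sgraph = "'v set \<times> 'v set set"

definition complete_sgraph :: "'v sgraph \<Rightarrow> bool" where
  "complete_sgraph G \<longleftrightarrow> (\<forall>x \<in> fst G. \<forall>y \<in> fst G. x \<noteq> y \<longrightarrow> {x, y} \<in> snd G)"

definition ext_zd_graph :: "('a, 'm) ring_scheme \<Rightarrow> 'a sgraph" where
  "ext_zd_graph A =
     (let V = zero_divisors A - {\<zero>\<^bsub>A\<^esub>} in
      (V, {{x, y} | x y. x \<in> V \<and> y \<in> V \<and> x \<noteq> y \<and>
             (\<exists>(n::nat) (m::nat). n \<ge> 1 \<and> m \<ge> 1 \<and>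
                x [^]\<^bsub>A\<^esub> n \<otimes>\<^bsub>A\<^esub> y [^]\<^bsub>A\<^esub> m = \<zero>\<^bsub>A\<^esub> \<and>
                x [^]\<^bsub>A\<^esub> n \<noteq> \<zero>\<^bsub>A\<^esub> \<and> y [^]\<^bsub>A\<^esub> m \<noteq> \<zero>\<^bsub>A\<^esub>)}))"

definition amalg_dup_set :: "('a, 'm) ring_scheme \<Rightarrow> 'a set \<Rightarrow> ('a \<times> 'a) set" where
  "amalg_dup_set R I = {(r, r \<oplus>\<^bsub>R\<^esub> i) | r i. r \<in> carrier R \<and> i \<in> I}"

definition amalg_dup :: "('a, 'm) ring_scheme \<Rightarrow> 'a set \<Rightarrow> ('a \<times> 'a) ring" where
  "amalg_dup R I = (RDirProd R R)\<lparr>carrier := amalg_dup_set R I\<rparr>"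

lemma amalg_dup_set_subring:
  fixes R (structure)
  assumes "cring R" and "ideal I R"
  shows "subring (amalg_dup_set R I) (RDirProd R R)"
proof -
  interpret R: cring R by fact
  interpret I: ideal I R by fact
  interpret P: ring "RDirProd R R" by (rule RDirProd_ring) (fact R.ring_axioms)+
  have sub: "amalg_dup_set R I \<subseteq> carrier (RDirProd R R)"
    unfolding amalg_dup_set_def RDirProd_carrier by auto
  have one: "\<one>\<^bsub>RDirProd R R\<^esub> = (\<one>, \<one>)"
    and mult: "\<And>a b c d. (a, b) \<otimes>\<^bsub>RDirProd R R\<^esub> (c, d) = (a \<otimes> c, b \<otimes> d)"
    and add: "\<And>a b c d. (a, b) \<oplus>\<^bsub>RDirProd R R\<^esub> (c, d) = (a \<oplus> c, b \<oplus> d)"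
    and zero: "\<zero>\<^bsub>RDirProd R R\<^esub> = (\<zero>, \<zero>)"
    by (simp_all add: RDirProd_def DirProd_def monoid.defs)
  have neg: "\<ominus>\<^bsub>RDirProd R R\<^esub> (a, b) = (\<ominus> a, \<ominus> b)" if "a \<in> carrier R" "b \<in> carrier R" for a b
    by (rule P.minus_equality) (auto simp: add zero that RDirProd_carrier R.l_neg)
  show ?thesis
  proof (rule P.subringI[OF sub])
    show "\<one>\<^bsub>RDirProd R R\<^esub> \<in> amalg_dup_set R I"
      unfolding one amalg_dup_set_def 
      by (rule CollectI, intro exI[of _ \<one>] exI[of _ \<zero>]) simp
  next
    fix h assume "h \<in> amalg_dup_set R I"
    then obtain r i where h: "h = (r, r \<oplus> i)" "r \<in> carrier R" "i \<in> I"
      unfolding amalg_dup_set_def by auto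
    then have "\<ominus>\<^bsub>RDirProd R R\<^esub> h = (\<ominus> r, \<ominus> r \<oplus> \<ominus> i)"
      using I.a_subset by (auto simp: neg R.minus_add)
    then show "\<ominus>\<^bsub>RDirProd R R\<^esub> h \<in> amalg_dup_set R I"
      unfolding amalg_dup_set_def using h by blast
  next
    fix h k assume "h \<in> amalg_dup_set R I" "k \<in> amalg_dup_set R I"
    then obtain r i s j where h: "h = (r, r \<oplus> i)" "r \<in> carrier R" "i \<in> I"
      and k: "k = (s, s \<oplus> j)" "s \<in> carrier R" "j \<in> I"
      unfolding amalg_dup_set_def by auto
    have ij: "i \<in> carrier R" "j \<in> carrier R" using h k I.a_subset by auto
    have "h \<otimes>\<^bsub>RDirProd R R\<^esub> k = (r \<otimes> s, r \<otimes> s \<oplus> (r \<otimes> j \<oplus> i \<otimes> (s \<oplus> j)))"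
      using h k ij by (simp add: mult R.l_distr R.r_distr R.a_ac)
    moreover have "r \<otimes> j \<oplus> i \<otimes> (s \<oplus> j) \<in> I"
      using h k ij by (intro I.a_closed I.I_l_closed I.I_r_closed) auto
    ultimately show "h \<otimes>\<^bsub>RDirProd R R\<^esub> k \<in> amalg_dup_set R I"
      unfolding amalg_dup_set_def using h(2) k(2) by (blast intro: R.m_closed)
    have "h \<oplus>\<^bsub>RDirProd R R\<^esub> k = (r \<oplus> s, r \<oplus> s \<oplus> (i \<oplus> j))"
      using h k ij by (simp add: add R.a_ac)
    then show "h \<oplus>\<^bsub>RDirProd R R\<^esub> k \<in> amalg_dup_set R I"
      unfolding amalg_dup_set_def using h(2,3) k(2,3) by (blast intro: R.a_closed I.a_closed)
  qed
qed

end

theory Submission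
  imports Defs
begin

text \<open>
  The zero-divisors \<open>(x, x)\<close> with \<open>x \<in> Z(R)\<close>, \<open>(x, x + i)\<close> and \<open>(0, i)\<close>, \<open>i \<in> I\<close>, are enough to
  test completeness. If \<open>x\<close> is a zero-divisor that is not nilpotent, then \<open>(x, x)\<close> is adjacent to no
  vertex with first coordinate \<open>x\<close>; applied to \<open>(x, x + i x)\<close> this forces \<open>x I = 0\<close>, and then
  \<open>(x, x + i)\<close> is such a vertex, because \<open>(i, 0)\<close> annihilates it. Conversely, under (2) every vertex
  of the graph is nilpotent, and the last non-zero powers of any two vertices multiply to zero in
  each coordinate.
\<close>

section \<open>Zero-divisors, nilpotents and the extended graph of a commutative ring\<close>

context cring
begin

lemma nat_pow_mult_zero_mono:
  fixes n m :: nat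
  assumes "x \<in> carrier R" "y \<in> carrier R" "x [^] n \<otimes> y [^] m = \<zero>" "n \<le> n'" "m \<le> m'"
  shows "x [^] n' \<otimes> y [^] m' = \<zero>"
proof -
  obtain k l where kl: "n' = n + k" "m' = m + l"
    using assms(4,5) by (auto simp: le_iff_add)
  have "x [^] n' \<otimes> y [^] m' = (x [^] n \<otimes> y [^] m) \<otimes> (x [^] k \<otimes> y [^] l)"
    using assms(1,2) by (simp add: kl nat_pow_mult [symmetric] m_ac)
  then show ?thesis
    using assms(1-3) by simp
qed

lemma nat_pow_zero_mono:
  fixes n :: nat
  assumes "x \<in> carrier R" "x [^] n = \<zero>" "n \<le> m"
  shows "x [^] m = \<zero>"
  using nat_pow_mult_zero_mono [of x x n 0 m 0] assms by simp

lemma zero_divisors_closed: "x \<in> zero_divisors R \<Longrightarrow> x \<in> carrier R"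
  by (simp add: zero_divisors_def)

lemma zero_divisorsI:
  "\<lbrakk>x \<in> carrier R; y \<in> carrier R; y \<noteq> \<zero>; x \<otimes> y = \<zero>\<rbrakk> \<Longrightarrow> x \<in> zero_divisors R"
  unfolding zero_divisors_def by blast

lemma zero_divisorsE:
  assumes "x \<in> zero_divisors R"
  obtains y where "x \<in> carrier R" "y \<in> carrier R" "y \<noteq> \<zero>" "x \<otimes> y = \<zero>"
  using assms unfolding zero_divisors_def by blast

lemma zero_in_zero_divisors: "\<one> \<noteq> \<zero> \<Longrightarrow> \<zero> \<in> zero_divisors R"
  by (rule zero_divisorsI [of _ \<one>]) auto

text \<open>Either \<open>x [^] n \<otimes> y\<close> is non-zero and witnesses that
  \<open>x\<close> is a zero-divisor, or it vanishes and the exponent drops by one. The descent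
  cannot reach 0, since \<open>y \<noteq> \<zero>\<close>.\<close>

lemma zero_divisor_of_nat_pow:
  fixes n :: nat
  assumes x: "x \<in> carrier R" and y: "y \<in> carrier R" "y \<noteq> \<zero>" and "x [^] n \<otimes> y = \<zero>"
  shows "x \<in> zero_divisors R"
  using assms(4)
proof (induction n)
  case 0
  then show ?case using y by simp
next
  case (Suc n)
  then have "x \<otimes> (x [^] n \<otimes> y) = \<zero>"
    using x y by (simp add: m_ac)
  then show ?case
    using Suc.IH x y zero_divisorsI [of x "x [^] n \<otimes> y"] by auto
qed

lemma nilpotents_closed: "x \<in> nilpotents R \<Longrightarrow> x \<in> carrier R"
  by (simp add: nilpotents_def)

text \<open>Exponent 0 is allowed here, so the positive exponent that \<open>nilpotents\<close>
  demands is taken to be \<open>Suc n\<close>.\<close>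

lemma nilpotentsI: "\<lbrakk>x \<in> carrier R; x [^] (n::nat) = \<zero>\<rbrakk> \<Longrightarrow> x \<in> nilpotents R"
  unfolding nilpotents_def
  by (intro CollectI conjI exI [of _ "Suc n"]) (simp_all add: nat_pow_zero_mono [of x n "Suc n"])

lemma nilpotents_subset_zero_divisors:
  assumes "\<one> \<noteq> \<zero>"
  shows "nilpotents R \<subseteq> zero_divisors R"
proof
  fix x assume "x \<in> nilpotents R"
  then obtain n :: nat where "x \<in> carrier R" "x [^] n = \<zero>"
    unfolding nilpotents_def by auto
  then show "x \<in> zero_divisors R"
    using zero_divisor_of_nat_pow [of x \<one> n] assms by simp
qed

lemma nat_pow_nilpotency_index:
  assumes "x \<in> nilpotents R"
  shows "nilpotency_index R x \<ge> 1" "x [^] nilpotency_index R x = \<zero>"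
proof -
  have "\<exists>n::nat. n \<ge> 1 \<and> x [^] n = \<zero>"
    using assms by (simp add: nilpotents_def)
  from LeastI_ex [OF this]
  show "nilpotency_index R x \<ge> 1" "x [^] nilpotency_index R x = \<zero>"
    by (simp_all add: nilpotency_index_def)
qed

lemma nat_pow_neq_zero_imp_le:
  assumes "x \<in> nilpotents R" "x [^] (n::nat) \<noteq> \<zero>"
  shows "n \<le> nilpotency_index R x - 1"
  using nat_pow_nilpotency_index [OF assms(1)] nilpotents_closed [OF assms(1)] assms(2)
    nat_pow_zero_mono [of x "nilpotency_index R x" n] by linarith

lemma nilpotency_index_ge_2:
  assumes "x \<in> nilpotents R" "x \<noteq> \<zero>"
  shows "nilpotency_index R x \<ge> 2"
  using nat_pow_neq_zero_imp_le [OF assms(1), of 1] assms nilpotents_closed [OF assms(1)]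
  by simp

lemma nilpotency_index_le:
  assumes "n \<ge> 1" "x [^] (n::nat) = \<zero>"
  shows "nilpotency_index R x \<le> n"
  using assms by (simp add: nilpotency_index_def Least_le)

text \<open>Index 1 gives the exponent 0 and hence the power \<open>\<one>\<close>, which is where
  \<open>\<one> \<noteq> \<zero>\<close> enters. For a larger index the claim is minimality.\<close>

lemma nat_pow_pred_nilpotency_index:
  assumes "x \<in> nilpotents R" "\<one> \<noteq> \<zero>"
  shows "x [^] (nilpotency_index R x - 1) \<noteq> \<zero>"
proof (cases "nilpotency_index R x = 1")
  case True
  then show ?thesis using assms(2) by simp
next
  case False
  then show ?thesis
    using nilpotency_index_le [of "nilpotency_index R x - 1" x]
      nat_pow_nilpotency_index(1) [OF assms(1)] by force
qed

text \<open>The last non-zero power \<open>z\<close> of \<open>x\<close> kills \<open>x\<close>.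
  Multiplying \<open>z\<close> by powers of \<open>y\<close> for as long as the product stays
  non-zero yields an element that kills both \<open>x\<close> and \<open>y\<close>. No binomial
  expansion is needed: once all zero-divisors are nilpotent, the sum is nilpotent too.\<close>

lemma nilpotents_add_zero_divisor:
  assumes x: "x \<in> nilpotents R" and y: "y \<in> nilpotents R" and "\<one> \<noteq> \<zero>"
  shows "x \<oplus> y \<in> zero_divisors R"
proof -
  define z where "z = x [^] (nilpotency_index R x - 1)"
  note xR = nilpotents_closed [OF x] and yR = nilpotents_closed [OF y]
  have z: "z \<in> carrier R" "z \<noteq> \<zero>" "z \<otimes> x = \<zero>"
    using xR nat_pow_pred_nilpotency_index [OF x assms(3)] nat_pow_nilpotency_index [OF x]
    by (simp_all add: z_def flip: nat_pow_Suc)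
  define l where "l = (LEAST l::nat. z \<otimes> y [^] l = \<zero>)"
  have "z \<otimes> y [^] nilpotency_index R y = \<zero>"
    using z(1) nat_pow_nilpotency_index [OF y] by simp
  then have l: "z \<otimes> y [^] l = \<zero>"
    unfolding l_def by (rule LeastI)
  \<comment> \<open>\<open>l\<close> is positive because exponent 0 gives \<open>z\<close> itself,
    which is non-zero.\<close>
  then obtain k where k: "l = Suc k"
    using z by (cases l) auto
  have nz: "z \<otimes> y [^] k \<noteq> \<zero>"
    using not_less_Least [of k "\<lambda>l. z \<otimes> y [^] l = \<zero>"] k by (simp add: l_def)
  have "(x \<oplus> y) \<otimes> (z \<otimes> y [^] k) = (z \<otimes> x) \<otimes> y [^] k \<oplus> z \<otimes> y [^] l"
  proof -
    have "(x \<oplus> y) \<otimes> (z \<otimes> y [^] k) = x \<otimes> (z \<otimes> y [^] k) \<oplus> y \<otimes> (z \<otimes> y [^] k)"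
      using z(1) xR yR by (simp add: l_distr)
    then show ?thesis
      using z(1) xR yR by (simp add: k m_ac)
  qed
  then have "(x \<oplus> y) \<otimes> (z \<otimes> y [^] k) = \<zero>"
    using z(3) l yR by simp
  then show ?thesis
    using zero_divisorsI [of "x \<oplus> y" "z \<otimes> y [^] k"] nz z(1) xR yR by simp
qed

lemma complete_ext_zd_graph_iff:
  "complete_sgraph (ext_zd_graph R) \<longleftrightarrow>
    (\<forall>x \<in> zero_divisors R - {\<zero>}. \<forall>y \<in> zero_divisors R - {\<zero>}. x \<noteq> y \<longrightarrow>
      (\<exists>(n::nat) (m::nat). n \<ge> 1 \<and> m \<ge> 1 \<and>
        x [^] n \<otimes> y [^] m = \<zero> \<and> x [^] n \<noteq> \<zero> \<and> y [^] m \<noteq> \<zero>))"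
proof -
  define V where "V = zero_divisors R - {\<zero>}"
  define P where "P x y \<longleftrightarrow> (\<exists>(n::nat) (m::nat). n \<ge> 1 \<and> m \<ge> 1 \<and>
    x [^] n \<otimes> y [^] m = \<zero> \<and> x [^] n \<noteq> \<zero> \<and> y [^] m \<noteq> \<zero>)" for x y
  have graph: "ext_zd_graph R = (V, {{x, y} | x y. x \<in> V \<and> y \<in> V \<and> x \<noteq> y \<and> P x y})"
    by (simp add: ext_zd_graph_def Let_def V_def P_def)
  \<comment> \<open>An edge is an unordered pair, so its set-builder presentation may list the
    endpoints in either order. Symmetry of \<open>P\<close> lets adjacency be read off in the order
    given.\<close>
  have sym: "P x y" if P: "P y x" and V: "x \<in> V" "y \<in> V" for x y
  proof -
    obtain n m :: nat where nm: "n \<ge> 1" "m \<ge> 1" "y [^] n \<otimes> x [^] m = \<zero>"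
      "y [^] n \<noteq> \<zero>" "x [^] m \<noteq> \<zero>"
      using P unfolding P_def by blast
    moreover have "x [^] m \<otimes> y [^] n = \<zero>"
      using nm(3) V by (simp add: V_def zero_divisors_closed m_comm)
    ultimately show ?thesis unfolding P_def by blast
  qed
  have "{x, y} \<in> snd (ext_zd_graph R) \<longleftrightarrow> P x y" if "x \<in> V" "y \<in> V" "x \<noteq> y" for x y
    using that sym by (auto simp: graph doubleton_eq_iff)
  then have "complete_sgraph (ext_zd_graph R) \<longleftrightarrow> (\<forall>x \<in> V. \<forall>y \<in> V. x \<noteq> y \<longrightarrow> P x y)"
    unfolding complete_sgraph_def by (auto simp: graph)
  then show ?thesis
    by (simp only: V_def P_def)
qed

end

section \<open>The amalgamated duplication as a commutative ring with coordinatewise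
  operations\<close>

lemma nat_pow_RDirProd_carrier_update:
  "(a, b) [^]\<^bsub>(RDirProd R S)\<lparr>carrier := C\<rparr>\<^esub> (n::nat) = (a [^]\<^bsub>R\<^esub> n, b [^]\<^bsub>S\<^esub> n)"
  by (induction n) (simp_all add: nat_pow_def RDirProd_def DirProd_def monoid.defs)

lemma amalg_dup_simps:
  "carrier (amalg_dup R I) = amalg_dup_set R I"
  "\<zero>\<^bsub>amalg_dup R I\<^esub> = (\<zero>\<^bsub>R\<^esub>, \<zero>\<^bsub>R\<^esub>)"
  "(a, b) \<otimes>\<^bsub>amalg_dup R I\<^esub> (c, d) = (a \<otimes>\<^bsub>R\<^esub> c, b \<otimes>\<^bsub>R\<^esub> d)"
  "(a, b) [^]\<^bsub>amalg_dup R I\<^esub> (n::nat) = (a [^]\<^bsub>R\<^esub> n, b [^]\<^bsub>R\<^esub> n)"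
  by (simp_all add: amalg_dup_def nat_pow_RDirProd_carrier_update)
    (simp_all add: RDirProd_def DirProd_def monoid.defs)

lemma amalg_dup_cring:
  assumes "cring R" "ideal I R"
  shows "cring (amalg_dup R I)"
proof -
  interpret R: cring R by fact
  interpret P: ring "RDirProd R R" by (rule RDirProd_ring) (fact R.ring_axioms)+
  interpret P: cring "RDirProd R R"
    by unfold_locales
      (auto simp: RDirProd_carrier, auto simp: RDirProd_def DirProd_def monoid.defs R.m_comm)
  have sub: "subring (amalg_dup_set R I) (RDirProd R R)"
    by (rule amalg_dup_set_subring) fact+
  show ?thesis
    unfolding amalg_dup_def
    using P.subcring_iff [OF subringE(1) [OF sub]] P.subcringI' [OF sub] by blast
qed

theorem theorem3p2:
  fixes R :: "('a, 'm) ring_scheme" (structure)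
    and I :: "'a set"
  assumes "cring R"
    and "\<one> \<noteq> \<zero>"
    and "\<not> domain R"
    and "ideal I R"
    and "I \<noteq> {\<zero>}"
  shows "complete_sgraph (ext_zd_graph (amalg_dup R I)) \<longleftrightarrow>
    (zero_divisors R = nilpotents R \<and>
     I \<subseteq> zero_divisors R \<and>
     (\<forall>x \<in> zero_divisors R - {\<zero>}. \<forall>y \<in> zero_divisors R - {\<zero>}.
        x [^] (nilpotency_index R x - 1) \<otimes> y [^] (nilpotency_index R y - 1) = \<zero>))"
    (is "?complete \<longleftrightarrow> ?zn \<and> ?iz \<and> ?pow")
proof -
  interpret R: cring R by fact
  interpret I: ideal I R by fact
  let ?A = "amalg_dup R I"
  interpret A: cring ?A by (rule amalg_dup_cring) fact+
  note simps = amalg_dup_simps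
  have one_zero_A: "\<one>\<^bsub>?A\<^esub> \<noteq> \<zero>\<^bsub>?A\<^esub>"
    using assms(2) by (simp add: amalg_dup_def RDirProd_def DirProd_def monoid.defs)
  have mem: "(r, r \<oplus> i) \<in> carrier ?A" if "r \<in> carrier R" "i \<in> I" for r i
    using that by (auto simp: simps amalg_dup_set_def)
  have diag: "(r, r) \<in> carrier ?A" if "r \<in> carrier R" for r
    using mem [OF that, of \<zero>] that by simp
  \<comment> \<open>The elements \<open>(\<zero>, i)\<close> and \<open>(i, \<zero>)\<close>
    annihilate each other; the latter is \<open>i\<close> shifted by \<open>\<ominus> i\<close> in
    the second coordinate.\<close>
  have zero_left: "(\<zero>, i) \<in> carrier ?A" if "i \<in> I" for i
    using mem [of \<zero> i] that I.Icarr by simp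
  have zero_right: "(i, \<zero>) \<in> carrier ?A" if "i \<in> I" for i
    using mem [of i "\<ominus> i"] that I.Icarr by (simp add: R.r_neg)
  have diag_zd: "(x, x) \<in> zero_divisors ?A - {\<zero>\<^bsub>?A\<^esub>}" if x: "x \<in> zero_divisors R - {\<zero>}" for x
  proof -
    obtain y where "x \<in> carrier R" "y \<in> carrier R" "y \<noteq> \<zero>" "x \<otimes> y = \<zero>"
      using x by (auto elim: R.zero_divisorsE)
    then show ?thesis
      using A.zero_divisorsI [of "(x, x)" "(y, y)"] diag x by (auto simp: simps)
  qed
  obtain i where i: "i \<in> I" "i \<noteq> \<zero>"
    using assms(5) I.zero_closed by blast
  show ?thesis
  proof

    \<comment> \<open>From completeness to the conditions on R and I\<close>
    assume complete: ?complete
    \<comment> \<open>Products vanish in both coordinates, whereas a power of a pair is non-zero as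
      soon as one coordinate is.\<close>
    have adj: "\<exists>(n::nat) (m::nat). n \<ge> 1 \<and> m \<ge> 1 \<and> a [^] n \<otimes> c [^] m = \<zero> \<and>
        b [^] n \<otimes> d [^] m = \<zero> \<and> (a [^] n, b [^] n) \<noteq> (\<zero>, \<zero>) \<and> (c [^] m, d [^] m) \<noteq> (\<zero>, \<zero>)"
      if "(a, b) \<in> zero_divisors ?A - {\<zero>\<^bsub>?A\<^esub>}" "(c, d) \<in> zero_divisors ?A - {\<zero>\<^bsub>?A\<^esub>}"
        "(a, b) \<noteq> (c, d)" for a b c d
      using complete [unfolded A.complete_ext_zd_graph_iff, rule_format, OF that]
      by (simp only: simps prod.inject conj_assoc)
    have "x \<in> nilpotents R" if x: "x \<in> zero_divisors R" for x
    proof (rule ccontr)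
      assume nonnil: "x \<notin> nilpotents R"
      obtain y where y: "x \<in> carrier R" "y \<in> carrier R" "y \<noteq> \<zero>" "x \<otimes> y = \<zero>"
        using x by (auto elim: R.zero_divisorsE)
      have x0: "x \<noteq> \<zero>"
        using nonnil R.nilpotentsI [of \<zero> 1] by auto
      \<comment> \<open>The first coordinate of an adjacency between \<open>(x, x)\<close> and
        \<open>(x, x \<oplus> j)\<close> would read \<open>x [^] (n + m) = \<zero>\<close>. The two
        vertices must therefore coincide.\<close>
      have no_zd: "j = \<zero>" if j: "j \<in> I" "(x, x \<oplus> j) \<in> zero_divisors ?A" for j
      proof (rule ccontr)
        assume "j \<noteq> \<zero>"
        then have "(x, x) \<noteq> (x, x \<oplus> j)"
          using y(1) I.Icarr [OF j(1)] by simp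
        then obtain n m :: nat where "x [^] n \<otimes> x [^] m = \<zero>"
          using adj [of x x x "x \<oplus> j"] diag_zd x x0 j by (auto simp: simps)
        then show False
          using nonnil R.nilpotentsI [of x "n + m"] y(1) by (simp add: R.nat_pow_mult)
      qed
      have iR: "i \<in> carrier R"
        using i I.Icarr by blast
      have xi: "x \<otimes> i = \<zero>"
      proof (rule no_zd)
        show "x \<otimes> i \<in> I"
          using y(1) i by (simp add: I.I_l_closed)
        then have "(x, x \<oplus> x \<otimes> i) \<in> carrier ?A"
          using mem y(1) by blast
        \<comment> \<open>The second coordinate is a multiple of \<open>x\<close>, so whatever kills
          \<open>x\<close> kills it, and \<open>(y, y)\<close> annihilates the pair.\<close>
        moreover have "(x \<oplus> x \<otimes> i) \<otimes> y = \<zero>"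
        proof -
          have "x \<otimes> i \<otimes> y = (x \<otimes> y) \<otimes> i"
            using y(1,2) iR by (simp add: R.m_ac)
          then show ?thesis
            using y iR by (simp add: R.l_distr)
        qed
        ultimately show "(x, x \<oplus> x \<otimes> i) \<in> zero_divisors ?A"
          using A.zero_divisorsI [of _ "(y, y)"] diag y by (simp add: simps)
      qed
      have "(x, x \<oplus> i) \<in> zero_divisors ?A"
        using A.zero_divisorsI [of "(x, x \<oplus> i)" "(i, \<zero>)"] mem zero_right xi y(1) i iR
        by (simp add: simps)
      then show False
        using no_zd i by blast
    qed
    then have zn: ?zn
      using R.nilpotents_subset_zero_divisors assms(2) by blast
    have iz: ?iz
    proof
      fix j assume j: "j \<in> I"
      show "j \<in> zero_divisors R"
      proof (cases "j = \<zero>")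
        case True
        then show ?thesis
          using R.zero_in_zero_divisors assms(2) by simp
      next
        case False
        have jR: "j \<in> carrier R"
          using j I.Icarr by blast
        \<comment> \<open>Since R is not a domain, it has a non-zero zero-divisor \<open>a\<close>.
          Adjacency of \<open>(\<zero>, j)\<close> and \<open>(a, a)\<close> then makes a power of
          \<open>j\<close> kill a non-zero power of \<open>a\<close>.\<close>
        have "\<not> domain_axioms R"
          using assms(1,3) by (auto simp: domain_def)
        then obtain a b where ab: "a \<in> carrier R" "b \<in> carrier R" "a \<noteq> \<zero>" "b \<noteq> \<zero>" "a \<otimes> b = \<zero>"
          using assms(2) by (auto simp: domain_axioms_def)
        have "(\<zero>, j) \<in> zero_divisors ?A - {\<zero>\<^bsub>?A\<^esub>}"
          using A.zero_divisorsI [of "(\<zero>, j)" "(j, \<zero>)"] zero_left zero_right j jR False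
          by (simp add: simps)
        moreover have "(a, a) \<in> zero_divisors ?A - {\<zero>\<^bsub>?A\<^esub>}"
          using diag_zd [of a] R.zero_divisorsI [of a b] ab by simp
        ultimately obtain n m :: nat where "j [^] n \<otimes> a [^] m = \<zero>" "a [^] m \<noteq> \<zero>"
          using adj [of \<zero> j a a] ab(3) by auto
        then show ?thesis
          using R.zero_divisor_of_nat_pow [of j "a [^] m" n] jR ab(1) by simp
      qed
    qed
    have ?pow
    proof (intro ballI)
      fix x y assume x: "x \<in> zero_divisors R - {\<zero>}" and y: "y \<in> zero_divisors R - {\<zero>}"
      have nil: "x \<in> nilpotents R" "y \<in> nilpotents R"
        using x y zn by auto
      note xy = R.nilpotents_closed [OF nil(1)] R.nilpotents_closed [OF nil(2)]
      show "x [^] (nilpotency_index R x - 1) \<otimes> y [^] (nilpotency_index R y - 1) = \<zero>"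
      proof (cases "x = y")
        case True
        \<comment> \<open>Completeness says nothing about equal vertices. Here
          \<open>x \<noteq> \<zero>\<close> gives index at least 2, so twice the index minus one is
          already large enough.\<close>
        have "nilpotency_index R x \<le> (nilpotency_index R x - 1) + (nilpotency_index R x - 1)"
          using R.nilpotency_index_ge_2 [OF nil(1)] x by simp
        then show ?thesis
          using R.nat_pow_zero_mono [OF xy(1) R.nat_pow_nilpotency_index(2) [OF nil(1)]] xy(1)
          unfolding True [symmetric] by (simp add: R.nat_pow_mult)
      next
        case False
        \<comment> \<open>Non-zero powers have exponents at most index minus one, so raising both
          exponents to those bounds keeps the product zero.\<close>
        then obtain n m :: nat where "x [^] n \<otimes> y [^] m = \<zero>" "x [^] n \<noteq> \<zero>" "y [^] m \<noteq> \<zero>"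
          using adj [OF diag_zd [OF x] diag_zd [OF y]] by auto
        then show ?thesis
          using R.nat_pow_mult_zero_mono R.nat_pow_neq_zero_imp_le nil xy by meson
      qed
    qed
    with zn iz show "?zn \<and> ?iz \<and> ?pow" by blast
  next

    \<comment> \<open>From the conditions on R and I to completeness\<close>
    assume "?zn \<and> ?iz \<and> ?pow"
    then have zn: ?zn and iz: ?iz and pow: ?pow by blast+
    have nil_add: "a \<oplus> i \<in> nilpotents R" if "a \<in> nilpotents R" "i \<in> I" for a i
      using R.nilpotents_add_zero_divisor [of a i] assms(2) that zn iz by blast
    have coords_nil: "\<exists>a b. X = (a, b) \<and> a \<in> nilpotents R \<and> b \<in> nilpotents R"
      if X: "X \<in> zero_divisors ?A" for X
    proof -
      obtain Y where XY: "X \<in> carrier ?A" "Y \<in> carrier ?A" "Y \<noteq> \<zero>\<^bsub>?A\<^esub>" "X \<otimes>\<^bsub>?A\<^esub> Y = \<zero>\<^bsub>?A\<^esub>"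
        using X by (rule A.zero_divisorsE)
      obtain a i where a: "X = (a, a \<oplus> i)" "a \<in> carrier R" "i \<in> I"
        using XY(1) by (auto simp: simps amalg_dup_set_def)
      obtain c j where c: "Y = (c, c \<oplus> j)" "c \<in> carrier R" "j \<in> I"
        using XY(2) by (auto simp: simps amalg_dup_set_def)
      note ij = I.Icarr [OF a(3)] I.Icarr [OF c(3)]
      \<comment> \<open>If \<open>c \<noteq> \<zero>\<close>, it is killed by \<open>a\<close>.
        Otherwise \<open>Y = (\<zero>, j)\<close> with \<open>j \<noteq> \<zero>\<close>, and
        \<open>a \<oplus> i\<close> kills \<open>j\<close>.\<close>
      have "a \<in> zero_divisors R \<or> a \<oplus> i \<in> zero_divisors R"
      proof (cases "c = \<zero>")
        case True
        then show ?thesis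
          using XY(3,4) a c ij R.zero_divisorsI [of "a \<oplus> i" j] by (simp add: simps)
      next
        case False
        then show ?thesis
          using XY(4) a c R.zero_divisorsI [of a c] by (simp add: simps)
      qed
      \<comment> \<open>The coordinates differ by an element of \<open>I\<close>, so
        \<open>nil_add\<close> carries nilpotency from either one to the other.\<close>
      moreover have "a = (a \<oplus> i) \<oplus> \<ominus> i"
        using a(2) ij(1) by (simp add: R.a_assoc R.r_neg)
      ultimately have "a \<in> nilpotents R"
        using nil_add [of "a \<oplus> i" "\<ominus> i"] a(3) I.a_inv_closed zn by auto
      then show ?thesis
        using a(1,3) nil_add by blast
    qed
    have nil_A: "X \<in> nilpotents ?A" if X: "X \<in> zero_divisors ?A" for X
    proof -
      obtain a b where ab: "X = (a, b)" "a \<in> nilpotents R" "b \<in> nilpotents R"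
        using coords_nil [OF X] by blast
      define n where "n = max (nilpotency_index R a) (nilpotency_index R b)"
      have "a [^] n = \<zero>" "b [^] n = \<zero>"
        using R.nat_pow_zero_mono [OF R.nilpotents_closed R.nat_pow_nilpotency_index(2)] ab
        by (simp_all add: n_def)
      then show ?thesis
        using A.nilpotentsI [of X n] A.zero_divisors_closed [OF X] ab(1) by (simp add: simps)
    qed
    \<comment> \<open>\<open>Suc n\<close> will be the index of a pair, which can exceed the index
      of a coordinate; hence only \<open>a [^] Suc n = \<zero>\<close> is required. A coordinate may
      also be \<open>\<zero>\<close>, which \<open>?pow\<close> does not cover; then
      \<open>n \<ge> 1\<close> and \<open>m \<ge> 1\<close> make the product vanish.\<close>
    have coord: "a [^] n \<otimes> b [^] m = \<zero>"
      if "a \<in> carrier R" "b \<in> carrier R" "a [^] Suc n = \<zero>" "b [^] Suc m = \<zero>" "n \<ge> 1" "m \<ge> 1"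
      for a b and n m :: nat
    proof (cases "a = \<zero> \<or> b = \<zero>")
      case True
      then show ?thesis
        using that by (auto simp: R.nat_pow_zero)
    next
      case False
      have nil: "a \<in> nilpotents R" "b \<in> nilpotents R"
        using that R.nilpotentsI [of a "Suc n"] R.nilpotentsI [of b "Suc m"] by blast+
      have "nilpotency_index R a - 1 \<le> n" "nilpotency_index R b - 1 \<le> m"
        using R.nilpotency_index_le [of "Suc n" a] R.nilpotency_index_le [of "Suc m" b] that
        by simp_all
      moreover have "a [^] (nilpotency_index R a - 1) \<otimes> b [^] (nilpotency_index R b - 1) = \<zero>"
        using pow zn nil False by blast
      ultimately show ?thesis
        using R.nat_pow_mult_zero_mono that(1,2) by blast
    qed
    show ?complete
      unfolding A.complete_ext_zd_graph_iff
    proof (intro ballI impI)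
      fix X Y assume X: "X \<in> zero_divisors ?A - {\<zero>\<^bsub>?A\<^esub>}" and Y: "Y \<in> zero_divisors ?A - {\<zero>\<^bsub>?A\<^esub>}"
      obtain a b where ab: "X = (a, b)" "a \<in> nilpotents R" "b \<in> nilpotents R"
        using coords_nil X by blast
      obtain c d where cd: "Y = (c, d)" "c \<in> nilpotents R" "d \<in> nilpotents R"
        using coords_nil Y by blast
      have nil: "X \<in> nilpotents ?A" "Y \<in> nilpotents ?A"
        using nil_A X Y by blast+
      \<comment> \<open>These exponents give the last non-zero powers. They are positive, as
        adjacency demands, because non-zero nilpotents have index at least 2.\<close>
      define n m where nm: "n = nilpotency_index ?A X - 1" "m = nilpotency_index ?A Y - 1"
      have ge: "n \<ge> 1" "m \<ge> 1"
        and Suc: "nilpotency_index ?A X = Suc n" "nilpotency_index ?A Y = Suc m"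
        using A.nilpotency_index_ge_2 [OF nil(1)] A.nilpotency_index_ge_2 [OF nil(2)] X Y
        unfolding nm by auto
      have nz: "X [^]\<^bsub>?A\<^esub> n \<noteq> \<zero>\<^bsub>?A\<^esub>" "Y [^]\<^bsub>?A\<^esub> m \<noteq> \<zero>\<^bsub>?A\<^esub>"
        using A.nat_pow_pred_nilpotency_index nil one_zero_A by (simp_all add: nm)
      have "a [^] Suc n = \<zero>" "b [^] Suc n = \<zero>" "c [^] Suc m = \<zero>" "d [^] Suc m = \<zero>"
        using A.nat_pow_nilpotency_index(2) [OF nil(1), unfolded Suc]
          A.nat_pow_nilpotency_index(2) [OF nil(2), unfolded Suc]
        by (simp_all only: ab(1) cd(1) simps prod.inject)
      then have "a [^] n \<otimes> c [^] m = \<zero>" "b [^] n \<otimes> d [^] m = \<zero>"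
        using coord ge ab cd R.nilpotents_closed by blast+
      then have "X [^]\<^bsub>?A\<^esub> n \<otimes>\<^bsub>?A\<^esub> Y [^]\<^bsub>?A\<^esub> m = \<zero>\<^bsub>?A\<^esub>"
        by (simp add: ab(1) cd(1) simps)
      then show "\<exists>(n::nat) (m::nat). n \<ge> 1 \<and> m \<ge> 1 \<and> X [^]\<^bsub>?A\<^esub> n \<otimes>\<^bsub>?A\<^esub> Y [^]\<^bsub>?A\<^esub> m = \<zero>\<^bsub>?A\<^esub> \<and>
          X [^]\<^bsub>?A\<^esub> n \<noteq> \<zero>\<^bsub>?A\<^esub> \<and> Y [^]\<^bsub>?A\<^esub> m \<noteq> \<zero>\<^bsub>?A\<^esub>"
        using ge nz by blast
    qed
  qed
qed

end
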